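(* For any integers $m\geq \ell\geq 0$ and $n\geq 0$, set $N=\min\{n+1,m-\ell\}$. Then $$\sum_{k=0}^{N}\det\begin{pmatrix} C_{n+k,2k} & C_{m+k,2k+\ell+1}\\ C_{n+k+1,2k} & C_{m+k+1,2k+\ell+1}\end{pmatrix}=C_{n}C_{m,\ell},$$ $$\sum_{k=0}^{N}\det\begin{pmatrix} C_{n+k+1,2k+1} & C_{m+k+1,2k+\ell+2}\\ C_{n+k+2,2k+1} & C_{m+k+2,2k+\ell+2}\end{pmatrix}=C_{n+1}C_{m,\ell},$$ or equivalently, $$C_{m,\ell}C_{n}=\sum_{k=0}^{N}\frac{(2k+1)(2k+\ell+2)\lambda_{n,k}(m,\ell)}{(2n+1)_3(2m-\ell)_3}\binom{2n+3}{n-k+1}\binom{2m-\ell+2}{m-k-\ell},$$ $$C_{m,\ell}C_{n+1}=\sum_{k=0}^{N}\frac{(2k+2)(2k+\ell+3)\mu_{n,k}(m,\ell)}{(2n+2)_3(2m-\ell+1)_3}\binom{2n+4}{n-k+1}\binom{2m-\ell+3}{m-k-\ell},$$ where $$\lambda_{n,k}(m,\ell)=(2m-\ell)(2m-\ell+1)(n-k+1)(n+k+2)-(2n+1)(2n+2)(m-\ell-k)(m+k+2),$$ $$\mu_{n,k}(m,\ell)=(2m-\ell+1)(2m-\ell+2)(n-k+1)(n+k+3)-(2n+2)(2n+3)(m-\ell-k)(m+k+3).$$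
   Context: $C_n=\frac{1}{n+1}\binom{2n}{n}$ is the $n$th Catalan number. For integers $n\geq k\geq 0$, $C_{n,k}=\frac{k+1}{n+1}\binom{2n-k}{n}$ (ballot numbers); these are the entries of an infinite lower triangular matrix, so $C_{n,k}=0$ for $k>n$. The rising factorial is $(x)_k=x(x+1)\cdots(x+k-1)$ for $k\geq 1$ and $(x)_0=1$.
   Formalization: The third identity is stated only for m > 0, since for m = ℓ = 0 its denominator (2m−ℓ)_3 and λ both vanish and the right-hand side is the undefined expression 0/0. *)

theory Defs
  imports "HOL-Analysis.Analysis"
begin

definition catalan :: "nat \<Rightarrow> real" where
  "catalan n = 1 / (real n + 1) * real ((2 * n) choose n)"

text \<open>Ballot numbers, extended by zero above the diagonal.\<close>

definition ballot :: "nat \<Rightarrow> nat \<Rightarrow> real" where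
  "ballot n k =
     (if k \<le> n then (real k + 1) / (real n + 1) * real ((2 * n - k) choose n) else 0)"

text \<open>Arguments are listed by rows.\<close>

definition mat2 :: "real \<Rightarrow> real \<Rightarrow> real \<Rightarrow> real \<Rightarrow> real^2^2" where
  "mat2 a b c d = vector [vector [a, b], vector [c, d]]"

text \<open>The differences below are taken over the reals, so they do not truncate: at
  the last summand, \<open>n - k\<close> may be \<open>-1\<close>.\<close>

definition lam :: "nat \<Rightarrow> nat \<Rightarrow> nat \<Rightarrow> nat \<Rightarrow> real" where
  "lam n k m l =
     (2 * real m - real l) * (2 * real m - real l + 1) * (real n - real k + 1) * (real n + real k + 2)
     - (2 * real n + 1) * (2 * real n + 2) * (real m - real l - real k) * (real m + real k + 2)"

definition mu :: "nat \<Rightarrow> nat \<Rightarrow> nat \<Rightarrow> nat \<Rightarrow> real" where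
  "mu n k m l =
     (2 * real m - real l + 1) * (2 * real m - real l + 2) * (real n - real k + 1) * (real n + real k + 3)
     - (2 * real n + 2) * (2 * real n + 3) * (real m - real l - real k) * (real m + real k + 3)"

end

theory Submission
  imports Defs
begin

text \<open>
  The ballot number \<open>C\<^bsub>n,k\<^esub>\<close> counts the nonnegative \<open>\<plusminus>1\<close> walks from \<open>0\<close> with \<open>n\<close> up-steps and
  \<open>n - k\<close> down-steps, that is, of length \<open>2n - k\<close> and final height \<open>k\<close>. In the determinants, the two
  entries of a column are therefore the numbers of walks to one height whose lengths differ by
  two, and the two columns use heights \<open>h\<close> and \<open>h + l + 1\<close>, where \<open>h\<close> grows by two with each summand.

  Adding two steps to a walk acts on the sequence of counts, indexed by the final height in steps
  of two, as the symmetric operator with weights \<open>1, 2, 1\<close> (\<open>ballot_two_steps\<close>), up to a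
  correction at the lowest height. Each determinant thus has the shape \<open>b (T a) - a (T b)\<close>
  with \<open>T\<close> symmetric, so the sum telescopes as in the discrete Lagrange (Green) identity:
  only boundary terms survive (\<open>discrete_lagrange_identity\<close>). The upper one vanishes because
  walks cannot end above their length. At the lower end, the first column stops
  at the floor, whereas the second starts at height \<open>l + 1\<close> or \<open>l + 2\<close> and there also counts the
  walks that are at height \<open>l\<close> before one of the two added steps. Their number is
  \<open>C\<^bsub>m,l\<^esub>\<close>, and it is multiplied by the count at the lowest height in the first column,
  which is a Catalan number. This proves both determinant
  identities.

  The other two identities agree with these summand by summand: both entries of a column are
  rational multiples of one binomial coefficient (\<open>ballot_eq_binomial\<close>,
  \<open>ballot_shorter_eq_binomial\<close>), and factoring it out of each column leaves the polynomials
  \<open>\<lambda>\<close> and \<open>\<mu>\<close>.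
\<close>

section \<open>Recurrences for ballot numbers\<close>

text \<open>The reflection principle in closed form. The condition excludes only \<open>n = 0 < k\<close>, where the
  truncated difference \<open>2 * n - k\<close> gives a spurious \<open>0 choose 0\<close>.\<close>

lemma ballot_reflection:
  assumes "k \<le> n \<or> 0 < n"
  shows "ballot n k = real ((2 * n - k) choose n) - real ((2 * n - k) choose Suc n)"
proof (cases "k \<le> n")
  case True
  then obtain d where n: "n = k + d" using le_Suc_ex by blast
  have L: "2 * n - k = n + d" using n by simp
  have "Suc n * ((n + d) choose Suc n) = d * ((n + d) choose n)"
    using binomial_absorb_comp[of "n + d" n] binomial_absorption[of n "n + d"]
    by (metis diff_add_inverse)
  then have "real (Suc n) * real ((n + d) choose Suc n) = real d * real ((n + d) choose n)"
    by (metis of_nat_mult)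
  then have "real ((n + d) choose Suc n) = real d * real ((n + d) choose n) / (real n + 1)"
    by (simp add: field_simps)
  moreover have "real d = real n - real k" using n by simp
  ultimately show ?thesis
    using True unfolding ballot_def L by (simp add: field_simps)
next
  case False
  then show ?thesis using assms by (simp add: ballot_def binomial_eq_0)
qed

text \<open>The two summands count walks by their last step. For \<open>k > n\<close> all three terms are zero.\<close>

lemma ballot_Suc_Suc:
  "ballot (Suc n) (Suc k) = ballot n k + ballot (Suc n) (Suc (Suc k))"
proof (cases "k \<le> n")
  case True
  then have "2 * Suc n - Suc k = Suc (2 * n - k)" "2 * Suc n - Suc (Suc k) = 2 * n - k" by auto
  then show ?thesis using True by (simp add: ballot_reflection del: mult_Suc_right)
next
  case False
  then show ?thesis by (simp add: ballot_def)
qed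

text \<open>A walk that ends on the floor arrived there by a down-step.\<close>

lemma ballot_Suc_0: "ballot (Suc n) 0 = ballot (Suc n) 1"
proof -
  have "2 * Suc n - 0 = Suc (2 * n + 1)" "2 * Suc n - 1 = 2 * n + 1" by auto
  moreover have "((2 * n + 1) choose Suc n) = ((2 * n + 1) choose n)"
    using binomial_symmetric[of n "2 * n + 1"] by simp
  ultimately show ?thesis by (simp add: ballot_reflection del: mult_Suc_right)
qed

lemma ballot_two_steps:
  "ballot (n + 2) (k + 2) = ballot n k + 2 * ballot (n + 1) (k + 2) + ballot (n + 2) (k + 4)"
  using ballot_Suc_Suc[of "n + 1" "k + 1"] ballot_Suc_Suc[of n k]
    ballot_Suc_Suc[of "n + 1" "k + 2"]
  by (simp add: eval_nat_numeral)

lemma catalan_eq_ballot: "catalan n = ballot n 0"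
  by (simp add: catalan_def ballot_def)

lemma catalan_Suc_eq_ballot: "catalan (Suc n) = ballot (Suc n) 1"
  by (simp only: catalan_eq_ballot ballot_Suc_0)

section \<open>The telescoping sum\<close>

text \<open>The images \<open>a'\<close> and \<open>b'\<close> of \<open>a\<close> and \<open>b\<close> come from one symmetric tridiagonal operator, with
  the corner entry \<open>c\<close>, except that \<open>a'\<close> has an extra source \<open>x\<close> at \<open>0\<close>. By symmetry, the summands
  are differences of consecutive Casoratians \<open>b k * a (k + 1) - a k * b (k + 1)\<close>.\<close>

lemma discrete_lagrange_identity:
  fixes a b a' b' :: "nat \<Rightarrow> 'a :: comm_ring_1"
  assumes a': "\<And>k. a' (Suc k) = a k + w * a (Suc k) + a (Suc (Suc k))"
    and b': "\<And>k. b' (Suc k) = b k + w * b (Suc k) + b (Suc (Suc k))"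
    and a0: "a' 0 = c * a 0 + a 1 + x"
    and b0: "b' 0 = c * b 0 + b 1"
  shows "(\<Sum>k=0..N. b k * a' k - a k * b' k) = b 0 * x + (b N * a (Suc N) - a N * b (Suc N))"
  by (induction N) (simp_all add: a' b' a0 b0 algebra_simps)

lemma det_mat2: "det (mat2 p q r s) = p * s - q * r"
  by (simp add: mat2_def det_2)

text \<open>On even heights the corner entry is \<open>1\<close>: from height \<open>0\<close>, only one of the two-step
  returns to \<open>0\<close> avoids the negative heights.\<close>

lemma sum_det_even:
  assumes "N = min (n + 1) (m - l)"
  shows "(\<Sum>k=0..N. det (mat2 (ballot (n+k) (2*k)) (ballot (m+k) (2*k+l+1))
                               (ballot (n+k+1) (2*k)) (ballot (m+k+1) (2*k+l+1))))
           = catalan n * ballot m l"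
proof -
  define a where "a k = ballot (m+k) (2*k+l+1)" for k
  define b where "b k = ballot (n+k) (2*k)" for k
  have "(\<Sum>k=0..N. b k * ballot (m+k+1) (2*k+l+1) - a k * ballot (n+k+1) (2*k))
      = b 0 * ballot m l + (b N * a (Suc N) - a N * b (Suc N))"
  proof (rule discrete_lagrange_identity[where w = 2 and c = 1])
    show "ballot (m + Suc k + 1) (2 * Suc k + l + 1) = a k + 2 * a (Suc k) + a (Suc (Suc k))" for k
      using ballot_two_steps[of "m+k" "2*k+l+1"] by (simp add: a_def eval_nat_numeral)
    show "ballot (n + Suc k + 1) (2 * Suc k) = b k + 2 * b (Suc k) + b (Suc (Suc k))" for k
      using ballot_two_steps[of "n+k" "2*k"] by (simp add: b_def eval_nat_numeral)
    show "ballot (m + 0 + 1) (2 * 0 + l + 1) = 1 * a 0 + a 1 + ballot m l"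
      using ballot_Suc_Suc[of m l] ballot_Suc_Suc[of m "Suc l"]
      by (simp add: a_def eval_nat_numeral)
    show "ballot (n + 0 + 1) (2 * 0) = 1 * b 0 + b 1"
      using ballot_Suc_0[of n] ballot_Suc_Suc[of n 0] by (simp add: b_def eval_nat_numeral)
  qed
  moreover have "a (Suc N) = 0 \<or> b N = 0" "a N = 0 \<or> b (Suc N) = 0"
    using assms by (auto simp: a_def b_def ballot_def min_def)
  then have "b N * a (Suc N) - a N * b (Suc N) = 0" by auto
  ultimately show ?thesis
    by (simp add: det_mat2 a_def b_def catalan_eq_ballot)
qed

text \<open>On odd heights the corner entry is \<open>2\<close>, because both two-step returns to height \<open>1\<close> stay
  nonnegative.\<close>

lemma sum_det_odd:
  assumes "N = min (n + 1) (m - l)"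
  shows "(\<Sum>k=0..N. det (mat2 (ballot (n+k+1) (2*k+1)) (ballot (m+k+1) (2*k+l+2))
                               (ballot (n+k+2) (2*k+1)) (ballot (m+k+2) (2*k+l+2))))
           = catalan (n+1) * ballot m l"
proof -
  define a where "a k = ballot (m+k+1) (2*k+l+2)" for k
  define b where "b k = ballot (n+k+1) (2*k+1)" for k
  have "(\<Sum>k=0..N. b k * ballot (m+k+2) (2*k+l+2) - a k * ballot (n+k+2) (2*k+1))
      = b 0 * ballot m l + (b N * a (Suc N) - a N * b (Suc N))"
  proof (rule discrete_lagrange_identity[where w = 2 and c = 2])
    show "ballot (m + Suc k + 2) (2 * Suc k + l + 2) = a k + 2 * a (Suc k) + a (Suc (Suc k))" for k
      using ballot_two_steps[of "m+k+1" "2*k+l+2"] by (simp add: a_def eval_nat_numeral)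
    show "ballot (n + Suc k + 2) (2 * Suc k + 1) = b k + 2 * b (Suc k) + b (Suc (Suc k))" for k
      using ballot_two_steps[of "n+k+1" "2*k+1"] by (simp add: b_def eval_nat_numeral)
    show "ballot (m + 0 + 2) (2 * 0 + l + 2) = 2 * a 0 + a 1 + ballot m l"
      using ballot_two_steps[of m l] by (simp add: a_def eval_nat_numeral)
    show "ballot (n + 0 + 2) (2 * 0 + 1) = 2 * b 0 + b 1"
      using ballot_Suc_Suc[of "Suc n" 0] ballot_Suc_0[of n] ballot_Suc_Suc[of "Suc n" 1]
      by (simp add: b_def eval_nat_numeral)
  qed
  moreover have "a (Suc N) = 0 \<or> b N = 0" "a N = 0 \<or> b (Suc N) = 0"
    using assms by (auto simp: a_def b_def ballot_def min_def)
  then have "b N * a (Suc N) - a N * b (Suc N) = 0" by auto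
  ultimately show ?thesis
    using catalan_Suc_eq_ballot[of n] by (simp add: det_mat2 a_def b_def)
qed

section \<open>The binomial form of the summands\<close>

lemma ballot_eq_binomial:
  assumes "k \<le> n"
  shows "ballot n k
    = (real k + 1) / (2 * real n - real k + 1) * real ((2 * n - k + 1) choose (n - k))"
proof -
  obtain d where n: "n = k + d" using assms le_Suc_ex by blast
  have L: "2 * n - k = n + d" using n by simp
  have "Suc n * (Suc (n + d) choose Suc n) = Suc (n + d) * ((n + d) choose n)"
    by (rule Suc_times_binomial)
  then have "real (Suc n) * real (Suc (n + d) choose Suc n)
      = real (Suc (n + d)) * real ((n + d) choose n)"
    by (metis of_nat_mult)
  then have absorb: "real (Suc (n + d) choose Suc n)
      = real (Suc (n + d)) * real ((n + d) choose n) / real (Suc n)"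
    by (simp add: field_simps del: binomial_Suc_Suc of_nat_Suc)
  have "((2 * n - k + 1) choose (n - k)) = (Suc (n + d) choose Suc n)"
  proof -
    have "2 * n - k + 1 = Suc (n + d)" "n - k = d" "Suc (n + d) - d = Suc n" using n by auto
    then show ?thesis using binomial_symmetric[of d "Suc (n + d)"] by simp
  qed
  moreover have "2 * real n - real k + 1 = real (Suc (n + d))" using n by simp
  moreover have "ballot n k = (real k + 1) / real (Suc n) * real ((n + d) choose n)"
    using assms by (simp add: ballot_def L add.commute)
  ultimately show ?thesis
    by (simp only: absorb) (simp del: of_nat_Suc)
qed

text \<open>The binomial coefficient here is the one that \<open>ballot_eq_binomial\<close> gives for
  \<open>ballot (n + 1) k\<close>, so that it becomes a common factor of a column. At the boundary case
  \<open>k = n + 1\<close> both sides vanish.\<close>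

lemma ballot_shorter_eq_binomial:
  assumes "k \<le> n + 1"
  shows "ballot n k
    = (real k + 1) * (real n - real k + 1) * (real n + 2) / pochhammer (2 * real n - real k + 1) 3
      * real ((2 * n + 3 - k) choose (n + 1 - k))"
proof (cases "k = n + 1")
  case True
  then show ?thesis by (simp add: ballot_def)
next
  case False
  with assms obtain e where n: "n = k + e" using le_Suc_ex[of k n] by auto
  define M where "M = k + 2 * e + 1"
  have M: "2 * n - k + 1 = M" "2 * n + 3 - k = Suc (Suc M)" "n + 1 - k = Suc e" "n - k = e"
    using n by (auto simp: M_def)
  have "Suc e * (Suc (Suc M) choose Suc e) = Suc (Suc M) * (Suc M choose e)"
    by (rule Suc_times_binomial)
  moreover have "Suc M - e = k + e + 2" by (simp add: M_def)
  then have "(k + e + 2) * (Suc M choose e) = Suc M * (M choose e)"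
    using binomial_absorb_comp[of "Suc M" e] by (metis diff_Suc_1)
  ultimately have "Suc e * (k + e + 2) * (Suc (Suc M) choose Suc e)
      = Suc (Suc M) * Suc M * (M choose e)"
    by (metis (no_types, lifting) mult.assoc mult.left_commute)
  then have "real (Suc e) * real (k + e + 2) * real (Suc (Suc M) choose Suc e)
      = real (Suc (Suc M)) * real (Suc M) * real (M choose e)"
    by (metis of_nat_mult)
  moreover have "real (Suc e) = real n - real k + 1" "real (k + e + 2) = real n + 2"
    "real (Suc M) = real M + 1" "real (Suc (Suc M)) = real M + 2"
    using n by simp_all
  ultimately have absorb: "(real n - real k + 1) * (real n + 2) * real (Suc (Suc M) choose Suc e)
      = (real M + 2) * (real M + 1) * real (M choose e)" by metis
  have "real M > 0" "2 * real n - real k + 1 = real M" using n by (simp_all add: M_def)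
  moreover have "pochhammer (real M) 3 = real M * (real M + 1) * (real M + 2)"
    by (simp add: pochhammer_Suc eval_nat_numeral add.commute)
  moreover have "ballot n k = (real k + 1) / real M * real (M choose e)"
    using ballot_eq_binomial[of k n] n unfolding M(1,4) calculation(2) by simp
  moreover have "(real k + 1) * (real n - real k + 1) * (real n + 2)
        / (real M * (real M + 1) * (real M + 2)) * real (Suc (Suc M) choose Suc e)
      = (real k + 1) / (real M * (real M + 1) * (real M + 2))
        * ((real n - real k + 1) * (real n + 2) * real (Suc (Suc M) choose Suc e))"
    by simp
  moreover have "\<dots> = (real k + 1) / real M * real (M choose e)"
  proof -
    have "real M \<noteq> 0" "real M + 1 \<noteq> 0" "real M + 2 \<noteq> 0" using \<open>real M > 0\<close> by auto
    then show ?thesis unfolding absorb by simp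
  qed
  ultimately show ?thesis by (simp only: M)
qed

text \<open>The determinants of both families, with the common binomial coefficient taken out of each
  column. The remaining factor is \<open>\<lambda>\<close> or \<open>\<mu>\<close> for the respective values of the parameters; \<open>s\<close> and
  \<open>t\<close> are one more than the lengths of the walks in the upper row.\<close>

lemma det_ballot_eq_binomial:
  fixes s t :: real
  assumes "k \<le> n + 1" "j \<le> q + 1"
    and s: "s = 2 * real n - real k + 1" "s > 0"
    and t: "t = 2 * real q - real j + 1" "t > 0"
  shows "det (mat2 (ballot n k) (ballot q j) (ballot (n + 1) k) (ballot (q + 1) j))
    = (real k + 1) * (real j + 1)
        * (t * (t + 1) * (real n - real k + 1) * (real n + 2)
           - s * (s + 1) * (real q - real j + 1) * (real q + 2))
      / (pochhammer s 3 * pochhammer t 3)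
      * real ((2 * n + 3 - k) choose (n + 1 - k)) * real ((2 * q + 3 - j) choose (q + 1 - j))"
proof -
  define X where "X = real ((2 * n + 3 - k) choose (n + 1 - k))"
  define Y where "Y = real ((2 * q + 3 - j) choose (q + 1 - j))"
  have poch: "pochhammer r 3 = r * (r + 1) * (r + 2)" for r :: real
    by (simp add: pochhammer_Suc eval_nat_numeral add.commute)
  have longer: "ballot (i + 1) h
      = (real h + 1) / (2 * real i - real h + 3) * real ((2 * i + 3 - h) choose (i + 1 - h))"
    if "h \<le> i + 1" for i h
  proof -
    have "2 * (i + 1) - h + 1 = 2 * i + 3 - h" using that by auto
    moreover have "2 * real (i + 1) - real h + 1 = 2 * real i - real h + 3" by simp
    ultimately show ?thesis using ballot_eq_binomial[OF that] by metis
  qed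
  have "ballot n k = (real k + 1) * (real n - real k + 1) * (real n + 2) / (s * (s + 1) * (s + 2)) * X"
    "ballot q j = (real j + 1) * (real q - real j + 1) * (real q + 2) / (t * (t + 1) * (t + 2)) * Y"
    using ballot_shorter_eq_binomial assms by (simp_all add: X_def Y_def poch)
  moreover have "2 * real n - real k + 3 = s + 2" "2 * real q - real j + 3 = t + 2"
    using s t by auto
  then have "ballot (n + 1) k = (real k + 1) / (s + 2) * X"
    "ballot (q + 1) j = (real j + 1) / (t + 2) * Y"
    using longer assms unfolding X_def Y_def by metis+
  moreover have "s \<noteq> 0" "s + 1 \<noteq> 0" "s + 2 \<noteq> 0" "t \<noteq> 0" "t + 1 \<noteq> 0" "t + 2 \<noteq> 0"
    using s t by auto
  \<comment> \<open>With the differences abstracted, this is an identity of rational functions.\<close>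
  moreover have "K * d * f / (s * (s + 1) * (s + 2)) * X * (J / (t + 2) * Y)
        - J * e * g / (t * (t + 1) * (t + 2)) * Y * (K / (s + 2) * X)
      = K * J * (t * (t + 1) * d * f - s * (s + 1) * e * g)
        / (s * (s + 1) * (s + 2) * (t * (t + 1) * (t + 2))) * X * Y" for K J d e f g :: real
    using calculation by (simp add: divide_simps) (simp add: algebra_simps)
  ultimately show ?thesis
    unfolding X_def[symmetric] Y_def[symmetric] det_mat2 poch by presburger
qed

lemma det_even_eq_lam:
  assumes "l \<le> m" "k \<le> n + 1" "k \<le> m - l" "m > 0"
  shows "det (mat2 (ballot (n+k) (2*k)) (ballot (m+k) (2*k+l+1))
                   (ballot (n+k+1) (2*k)) (ballot (m+k+1) (2*k+l+1)))
    = (2 * real k + 1) * (2 * real k + real l + 2) * lam n k m l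
        / (pochhammer (2 * real n + 1) 3 * pochhammer (2 * real m - real l) 3)
        * real ((2*n+3) choose (n+1-k)) * real ((2*m-l+2) choose (m-k-l))"
proof -
  have "2 * (n+k) + 3 - 2*k = 2*n+3" "n + k + 1 - 2*k = n+1-k"
    "2 * (m+k) + 3 - (2*k+l+1) = 2*m-l+2" "m + k + 1 - (2*k+l+1) = m-k-l"
    using assms by auto
  moreover have "lam n k m l
      = (2 * real m - real l) * (2 * real m - real l + 1)
          * (real (n+k) - real (2*k) + 1) * (real (n+k) + 2)
        - (2 * real n + 1) * (2 * real n + 1 + 1)
          * (real (m+k) - real (2*k+l+1) + 1) * (real (m+k) + 2)"
    by (simp add: lam_def algebra_simps)
  moreover have "real (2*k) + 1 = 2 * real k + 1" "real (2*k+l+1) + 1 = 2 * real k + real l + 2"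
    by auto
  moreover have "2*k \<le> n + k + 1" "2*k+l+1 \<le> m + k + 1"
    "2 * real n + 1 = 2 * real (n+k) - real (2*k) + 1" "2 * real n + 1 > 0"
    "2 * real m - real l = 2 * real (m+k) - real (2*k+l+1) + 1" "2 * real m - real l > 0"
    using assms by auto
  note det_ballot_eq_binomial[OF this]
  ultimately show ?thesis by metis
qed

lemma det_odd_eq_mu:
  assumes "l \<le> m" "k \<le> n + 1" "k \<le> m - l"
  shows "det (mat2 (ballot (n+k+1) (2*k+1)) (ballot (m+k+1) (2*k+l+2))
                   (ballot (n+k+2) (2*k+1)) (ballot (m+k+2) (2*k+l+2)))
    = (2 * real k + 2) * (2 * real k + real l + 3) * mu n k m l
        / (pochhammer (2 * real n + 2) 3 * pochhammer (2 * real m - real l + 1) 3)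
        * real ((2*n+4) choose (n+1-k)) * real ((2*m-l+3) choose (m-k-l))"
proof -
  have "2 * (n+k+1) + 3 - (2*k+1) = 2*n+4" "n + k + 1 + 1 - (2*k+1) = n+1-k"
    "2 * (m+k+1) + 3 - (2*k+l+2) = 2*m-l+3" "m + k + 1 + 1 - (2*k+l+2) = m-k-l"
    "n + k + 1 + 1 = n + k + 2" "m + k + 1 + 1 = m + k + 2"
    using assms by auto
  moreover have "mu n k m l
      = (2 * real m - real l + 1) * (2 * real m - real l + 1 + 1)
          * (real (n+k+1) - real (2*k+1) + 1) * (real (n+k+1) + 2)
        - (2 * real n + 2) * (2 * real n + 2 + 1)
          * (real (m+k+1) - real (2*k+l+2) + 1) * (real (m+k+1) + 2)"
    by (simp add: mu_def algebra_simps)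
  moreover have "real (2*k+1) + 1 = 2 * real k + 2" "real (2*k+l+2) + 1 = 2 * real k + real l + 3"
    by auto
  moreover have "2*k+1 \<le> n + k + 1 + 1" "2*k+l+2 \<le> m + k + 1 + 1"
    "2 * real n + 2 = 2 * real (n+k+1) - real (2*k+1) + 1" "2 * real n + 2 > 0"
    "2 * real m - real l + 1 = 2 * real (m+k+1) - real (2*k+l+2) + 1" "2 * real m - real l + 1 > 0"
    using assms by auto
  note det_ballot_eq_binomial[OF this]
  ultimately show ?thesis by metis
qed

section \<open>The four identities\<close>

(* In the third identity the denominator (2m - l)_3 vanishes exactly when m = l = 0, where its
   right-hand side is the undefined expression 0/0; hence the guard m > 0.
   In the binomial coefficients n - k + 1 is written n + 1 - k, since k = n + 1 can occur. *)

theorem theorem2p1: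
  fixes m l n :: nat
  assumes "l \<le> m"
  defines "N \<equiv> min (n + 1) (m - l)"
  shows "(\<Sum>k=0..N. det (mat2 (ballot (n+k) (2*k))   (ballot (m+k) (2*k+l+1))
                               (ballot (n+k+1) (2*k)) (ballot (m+k+1) (2*k+l+1))))
           = catalan n * ballot m l
       \<and> (\<Sum>k=0..N. det (mat2 (ballot (n+k+1) (2*k+1)) (ballot (m+k+1) (2*k+l+2))
                               (ballot (n+k+2) (2*k+1)) (ballot (m+k+2) (2*k+l+2))))
           = catalan (n+1) * ballot m l
       \<and> (m > 0 \<longrightarrow>
           ballot m l * catalan n
           = (\<Sum>k=0..N. (2 * real k + 1) * (2 * real k + real l + 2) * lam n k m l
                / (pochhammer (2 * real n + 1) 3 * pochhammer (2 * real m - real l) 3)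
                * real ((2*n+3) choose (n+1-k)) * real ((2*m-l+2) choose (m-k-l))))
       \<and> ballot m l * catalan (n+1)
           = (\<Sum>k=0..N. (2 * real k + 2) * (2 * real k + real l + 3) * mu n k m l
                / (pochhammer (2 * real n + 2) 3 * pochhammer (2 * real m - real l + 1) 3)
                * real ((2*n+4) choose (n+1-k)) * real ((2*m-l+3) choose (m-k-l)))"
proof -
  have N: "N = min (n + 1) (m - l)" by (simp add: N_def)
  then have le: "k \<le> n + 1" "k \<le> m - l" if "k \<in> {0..N}" for k using that by auto
  note even = sum_det_even[OF N] and odd = sum_det_odd[OF N]
  have lam_form: "ballot m l * catalan n
      = (\<Sum>k=0..N. (2 * real k + 1) * (2 * real k + real l + 2) * lam n k m l
           / (pochhammer (2 * real n + 1) 3 * pochhammer (2 * real m - real l) 3)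
           * real ((2*n+3) choose (n+1-k)) * real ((2*m-l+2) choose (m-k-l)))" if "m > 0"
    unfolding mult.commute[of "ballot m l"] even[symmetric]
    by (rule sum.cong[OF refl]) (rule det_even_eq_lam[OF assms(1) le that])
  have mu_form: "ballot m l * catalan (n+1)
      = (\<Sum>k=0..N. (2 * real k + 2) * (2 * real k + real l + 3) * mu n k m l
           / (pochhammer (2 * real n + 2) 3 * pochhammer (2 * real m - real l + 1) 3)
           * real ((2*n+4) choose (n+1-k)) * real ((2*m-l+3) choose (m-k-l)))"
    unfolding mult.commute[of "ballot m l"] odd[symmetric]
    by (rule sum.cong[OF refl]) (rule det_odd_eq_mu[OF assms(1) le])
  show ?thesis using even odd lam_form mu_form by blast
qed

end
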